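(* Let $q$ be an odd prime power. Then the quadrinomial $$f(X)=-X^2+2X^{q^2+1}+X^{2q}-X^{2q^2}\in\mathbb{F}_q[X]$$ is planar over $\mathbb{F}_{q^3}$.
   Context: For $q$ odd, a function $f:\mathbb{F}_{q^n}\to\mathbb{F}_{q^n}$ is called planar (over $\mathbb{F}_{q^n}$) if for every $\epsilon\in\mathbb{F}_{q^n}^*$ the polynomial $f(X+\epsilon)-f(X)$ induces a permutation of $\mathbb{F}_{q^n}$. *)

theory Defs
  imports
    "HOL-Library.Cardinality"
    "HOL-Number_Theory.Prime_Powers"
    "HOL-Computational_Algebra.Polynomial"
begin

definition planar :: "('a::finite_field \<Rightarrow> 'a) \<Rightarrow> bool" where
  "planar f \<longleftrightarrow> (\<forall>\<epsilon>. \<epsilon> \<noteq> 0 \<longrightarrow> bij (\<lambda>x. f (x + \<epsilon>) - f x))"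

(* All coefficients are integers, so over a field of order q^3 they lie in the prime field
   and hence in the subfield of order q. *)
definition quadrinomial :: "nat \<Rightarrow> 'a::comm_ring_1 poly" where
  "quadrinomial q =
     - monom 1 2 + monom 2 (q\<^sup>2 + 1) + monom 1 (2 * q) - monom 1 (2 * q\<^sup>2)"

end

theory Submission
  imports Defs "HOL-Number_Theory.Residues"
begin

text \<open>
  Writing \<open>a, b, c\<close> for \<open>e, e^q, e^(q^2)\<close> and \<open>x, y, z\<close> for the conjugates of \<open>x\<close>, we have
  \<open>f(x) = y^2 - (x - z)^2\<close>, so \<open>f\<close> is planar iff its polar form
  \<open>y b - (x - z) (a - c)\<close> vanishes only for \<open>x = 0\<close> or \<open>e = 0\<close>. If it vanishes, so do its
  conjugates, and these three equations are linear in \<open>x, y, z\<close> with determinant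
  \<open>(a + c - b) (b + a - c) (c + b - a)\<close>, the norm of \<open>a + c - b\<close>. A zero norm forces all
  three factors to vanish, and in odd characteristic this gives \<open>e = 0\<close>.
\<close>

lemma CHAR_eq_of_CARD_prime_power:
  assumes "prime p" "CARD('a::finite_field) = p ^ n"
  shows "CHAR('a) = p"
proof -
  have "CHAR('a) dvd p ^ n"
    using CHAR_dvd_CARD[where 'a = 'a] assms(2) by simp
  moreover have "prime CHAR('a)"
    by (rule prime_CHAR_semidom) (simp add: finite_imp_CHAR_pos)
  ultimately show ?thesis
    using assms(1) prime_dvd_power primes_dvd_imp_eq by blast
qed

lemma polar_form_nondegenerate:
  fixes a b c x y z :: "'a::idom"
  assumes "y * b = (x - z) * (a - c)"
    and "z * c = (y - x) * (b - a)"
    and "x * a = (z - y) * (c - b)"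
  shows "x * ((a + c - b) * (b + a - c) * (c + b - a)) = 0"
proof -
  \<comment> \<open>Cramer's rule: the multipliers are the cofactors of the \<open>x\<close> column
    of the linear system, so \<open>y\<close> and \<open>z\<close> cancel.\<close>
  have "x * ((a + c - b) * (b + a - c) * (c + b - a)) =
      ((a - b) * (b - c) - c * (c - b)) * (y * b - (x - z) * (a - c))
      + ((a - c) * (c - b) - b * (b - c)) * (z * c - (y - x) * (b - a))
      + (b * c - (a - c) * (a - b)) * (x * a - (z - y) * (c - b))"
    by (simp add: algebra_simps)
  then show ?thesis using assms by simp
qed

theorem theorem3p2:
  fixes q :: nat
  assumes "primepow q" and "odd q"
    and "CARD('a::finite_field) = q ^ 3"
  shows "planar (poly (quadrinomial q :: 'a poly))"
proof -
  obtain p k where p: "prime p" "k > 0" "q = p ^ k"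
    using assms(1) by (auto simp: primepow_def)
  have char: "CHAR('a) = p"
    by (rule CHAR_eq_of_CARD_prime_power[of p "k * 3"])
      (use p assms(3) in \<open>auto simp: power_mult\<close>)
  have "odd p" using p assms(2) by auto
  then have two: "(2::'a) \<noteq> 0"
    using of_nat_eq_0_iff_char_dvd[where 'a = 'a, of 2] char p(1)
    by (metis of_nat_numeral prime_nat_iff two_is_prime_nat primes_dvd_imp_eq even_numeral dvd_refl)
  \<comment> \<open>The Frobenius map over the subfield of order \<open>q\<close>; it yields the
    conjugates.\<close>
  define F where "F x = x ^ q" for x :: 'a
  have F_add: "F (x + y) = F x + F y" for x y
    unfolding F_def p(3) by (rule freshmans_dream'[of _ k]) (use char p in auto)
  have F_mult: "F (x * y) = F x * F y" for x y
    by (simp add: F_def power_mult_distrib)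
  have F_diff: "F (x - y) = F x - F y" for x y
    using F_add[of "x - y" y] by simp
  have q: "q > 0" using p prime_gt_0_nat by simp
  have F_0: "F x = 0 \<longleftrightarrow> x = 0" for x
    using q by (simp add: F_def)
  have F3: "F (F (F x)) = x" for x
    using finite_field_power_card_eq_same[of x] assms(3)
    by (simp add: F_def power_mult[symmetric] power3_eq_cube)
  define f where "f = poly (quadrinomial q :: 'a poly)"
  \<comment> \<open>The term of degree \<open>q\<^sup>2 + 1\<close> is the cross term of the second
    square.\<close>
  have f_eq: "f x = (F x)\<^sup>2 - (x - F (F x))\<^sup>2" for x
  proof -
    have "F (F x) = x ^ q\<^sup>2" "(F x)\<^sup>2 = x ^ (2 * q)" "(F (F x))\<^sup>2 = x ^ (2 * q\<^sup>2)"
      by (simp_all add: F_def power2_eq_square mult_2 power_add flip: power_mult)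
    then show ?thesis
      by (simp add: f_def quadrinomial_def poly_monom power2_diff power_add)
  qed
  have polar: "x = 0" if e: "e \<noteq> 0" and B: "F x * F e = (x - F (F x)) * (e - F (F e))" for x e
  proof -
    \<comment> \<open>As \<open>F\<close> has order dividing 3, applying it permutes the conjugates
      cyclically.\<close>
    have B2: "F (F x) * F (F e) = (F x - x) * (F e - e)"
      using arg_cong[OF B, of F] by (simp add: F_mult F_diff F3)
    have B3: "x * e = (F (F x) - F x) * (F (F e) - F e)"
      using arg_cong[OF B2, of F] by (simp add: F_mult F_diff F3)
    define N where "N = e + F (F e) - F e"
    have "x * (N * F N * F (F N)) = 0"
      using polar_form_nondegenerate[OF B B2 B3] by (simp add: N_def F_add F_diff F3)
    moreover have "N \<noteq> 0"
    proof
      assume "N = 0"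
      moreover from this have "F N = 0" by (simp add: F_0)
      moreover have "N + F N = 2 * e" by (simp add: N_def F_add F_diff F3)
      ultimately show False using two e by simp
    qed
    ultimately show "x = 0" by (simp add: F_0)
  qed
  have "bij (\<lambda>x. f (x + e) - f x)" if e: "e \<noteq> 0" for e
  proof -
    have "inj (\<lambda>x. f (x + e) - f x)"
    proof (rule injI)
      fix x y assume eq: "f (x + e) - f x = f (y + e) - f y"
      \<comment> \<open>\<open>f\<close> is a quadratic form, so \<open>f (x + e) - f x\<close> is
        additive in \<open>x\<close> up to the constant \<open>f e\<close>: the difference of two
        values is twice the polar form at \<open>x - y\<close> and \<open>e\<close>.\<close>
      have "2 * (F (x - y) * F e - (x - y - F (F (x - y))) * (e - F (F e)))
          = (f (x + e) - f x) - (f (y + e) - f y)"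
        unfolding f_eq F_add F_diff by (simp add: algebra_simps power2_eq_square)
      then have "x - y = 0" using polar[OF e, of "x - y"] eq two by simp
      then show "x = y" by simp
    qed
    then show ?thesis by (simp add: finite_UNIV_inj_surj bij_def)
  qed
  then show ?thesis unfolding planar_def f_def by blast
qed

end
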